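(* Let $A,B$ be infinite sets of nonnegative integers such that $r_{A,B}(n)=1$ for every nonnegative integer $n$. Then $d_{A,B}(n)=1$ for every integer $n$.
   Context: For nonempty sets $A,B$ of nonnegative integers and an integer $n$, $r_{A,B}(n)$ denotes the number of pairs $(a,b)\in A\times B$ with $a+b=n$, and $d_{A,B}(n)$ denotes the number of pairs $(a,b)\in A\times B$ with $a-b=n$. *)

theory Defs
  imports Main
begin

text \<open>
  Representation counts by sums and by differences. Both are cardinalities, so an infinite
  family of representations (possible only for differences) would be counted as \<open>0\<close>;
  the value \<open>1\<close> always means that there is exactly one representing pair.
\<close>

definition rep_sum :: "nat set \<Rightarrow> nat set \<Rightarrow> int \<Rightarrow> nat" where
  "rep_sum A B n = card {(a, b). a \<in> A \<and> b \<in> B \<and> int a + int b = n}"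

definition rep_diff :: "nat set \<Rightarrow> nat set \<Rightarrow> int \<Rightarrow> nat" where
  "rep_diff A B n = card {(a, b). a \<in> A \<and> b \<in> B \<and> int a - int b = n}"

end

theory Submission
  imports Defs
begin

text \<open>
  Uniqueness of differences is uniqueness of sums, since \<open>a - b = a' - b'\<close> means
  \<open>a + b' = a' + b\<close>. For existence, let \<open>1 \<in> A\<close> (otherwise \<open>1 \<in> B\<close>) and let \<open>g\<close> be the
  least positive element of \<open>B\<close>. As in de Bruijn's description of additive complements,
  \<open>A = {0..<g} + g A'\<close> and \<open>B = g B'\<close>, where \<open>A'\<close>, \<open>B'\<close> are again infinite complements
  and \<open>1 \<in> B'\<close>. A representation of \<open>n div g\<close> as a difference from \<open>A'\<close> and \<open>B'\<close> gives one
  of \<open>n\<close> from \<open>A\<close> and \<open>B\<close>, and \<open>n div g\<close> is smaller than \<open>n\<close> in absolute value except for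
  \<open>n = 0\<close> and \<open>n = -1\<close>; in the latter case \<open>n div g = -1 = 0 - 1\<close>.
\<close>

text \<open>A bijection of natural numbers in place of the counts \<open>rep_sum\<close>:
  surjectivity gives the existence of a representation and injectivity its uniqueness, with no
  cardinalities involved.\<close>

definition complements :: "nat set \<Rightarrow> nat set \<Rightarrow> bool" where
  "complements A B \<longleftrightarrow> bij_betw (\<lambda>(a, b). a + b) (A \<times> B) UNIV"

lemma complements_ex:
  assumes "complements A B"
  obtains a b where "a \<in> A" "b \<in> B" "a + b = n"
proof -
  have "n \<in> (\<lambda>(a, b). a + b) ` (A \<times> B)"
    using assms unfolding complements_def by (simp add: bij_betw_imp_surj_on)
  with that show ?thesis
    by auto
qed

lemma complements_unique:
  assumes "complements A B" "a \<in> A" "b \<in> B" "a' \<in> A" "b' \<in> B" "a + b = a' + b'"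
  shows "a = a'" and "b = b'"
proof -
  have "(a, b) = (a', b')"
    using assms unfolding complements_def
    by (intro inj_onD[OF bij_betw_imp_inj_on[of "\<lambda>(a, b). a + b"]]) auto
  then show "a = a'" and "b = b'"
    by simp_all
qed

lemma complementsI:
  assumes "\<And>n. \<exists>a\<in>A. \<exists>b\<in>B. a + b = n"
    and "\<And>a b a' b'. a \<in> A \<Longrightarrow> b \<in> B \<Longrightarrow> a' \<in> A \<Longrightarrow> b' \<in> B \<Longrightarrow> a + b = a' + b' \<Longrightarrow> a = a' \<and> b = b'"
  shows "complements A B"
  unfolding complements_def
proof (rule bij_betw_imageI)
  show "inj_on (\<lambda>(a, b). a + b) (A \<times> B)"
    using assms(2) by (auto intro!: inj_onI)
  have "n \<in> (\<lambda>(a, b). a + b) ` (A \<times> B)" for n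
    using assms(1)[of n] by force
  then show "(\<lambda>(a, b). a + b) ` (A \<times> B) = UNIV"
    by blast
qed

lemma complements_commute:
  assumes "complements A B"
  shows "complements B A"
proof (rule complementsI)
  show "\<exists>b\<in>B. \<exists>a\<in>A. b + a = n" for n
    using complements_ex[OF assms, of n] by (metis add.commute)
  show "b = b' \<and> a = a'"
    if "b \<in> B" "a \<in> A" "b' \<in> B" "a' \<in> A" "b + a = b' + a'" for b a b' a'
    using complements_unique[OF assms that(2,1,4,3)] that(5) by (simp add: add.commute)
qed

lemma complements_zero:
  assumes "complements A B"
  shows "0 \<in> A" and "0 \<in> B"
proof -
  obtain a b where "a \<in> A" "b \<in> B" "a + b = 0"
    using complements_ex[OF assms] .
  then show "0 \<in> A" and "0 \<in> B"
    by simp_all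
qed

lemma complements_one:
  assumes "complements A B"
  shows "1 \<in> A \<or> 1 \<in> B"
proof -
  obtain a b where "a \<in> A" "b \<in> B" "a + b = 1"
    using complements_ex[OF assms] .
  then show ?thesis
    by (cases a) auto
qed

text \<open>Strong induction on the block of length \<open>g\<close> starting at
  \<open>k * g\<close>. If \<open>k * g\<close> lies in \<open>A\<close>, a nonzero summand from
  \<open>B\<close> inside the block would produce a number with two representations. Otherwise
  \<open>k * g = a + b\<close> with \<open>b\<close> nonzero, and the block is the translate by
  \<open>b\<close> of an earlier block contained in \<open>A\<close>.\<close>

lemma complements_block:
  assumes AB: "complements A B"
    and g: "g \<in> B" "0 < g" "\<And>b. b \<in> B \<Longrightarrow> 0 < b \<Longrightarrow> g \<le> b"
  shows "(\<forall>r<g. k * g + r \<in> A \<longleftrightarrow> k * g \<in> A) \<and> (\<forall>r<g. k * g + r \<in> B \<longrightarrow> r = 0)"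
proof (induction k rule: less_induct)
  case (less k)
  note uniq = complements_unique[OF AB]
  note zero = complements_zero[OF AB]
  have initial: "r \<in> A" if "r < g" for r
  proof -
    obtain a b where "a \<in> A" "b \<in> B" "a + b = r"
      using complements_ex[OF AB] .
    with that g(3)[of b] show ?thesis
      by (cases "b = 0") auto
  qed
  have block: "j * g + r \<in> A \<longleftrightarrow> j * g \<in> A" if "j < k" "r < g" for j r
    using less.IH that by blast
  have B_multiple: "b = b div g * g" if "b \<in> B" "b < k * g" for b
  proof -
    have "b div g < k"
      using that(2) g(2) by (simp add: less_mult_imp_div_less)
    moreover have "b = b div g * g + b mod g" "b mod g < g"
      using g(2) by simp_all
    ultimately show ?thesis
      using less.IH that(1) by (metis add_0_right)
  qed
  show ?case
  proof (cases "k = 0")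
    case True
    with initial g(3) show ?thesis
      by (auto simp: zero) (metis not_le not_gr_zero)
  next
    case False
    show ?thesis
    proof (cases "k * g \<in> A")
      case True
      have not_B: "k * g + s \<notin> B" if "s < g" for s
      proof
        assume s: "k * g + s \<in> B"
        show False
        proof (cases "s = 0")
          case True
          with uniq[OF \<open>k * g \<in> A\<close> zero(2) zero(1) s] False g(2) show False
            by simp
        next
          case s0: False
          \<comment> \<open>The number \<open>k * g + g\<close> is also
            \<open>(g - s) + (k * g + s)\<close>, and the summands from \<open>A\<close> differ
            because \<open>g - s < g \<le> k * g\<close>.\<close>
          with g(2) have "g - s \<in> A"
            by (intro initial) simp
          with uniq(1)[OF \<open>k * g \<in> A\<close> g(1) _ s, of "g - s"] that have "k * g = g - s"
            by simp
          moreover have "g \<le> k * g"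
            using False by simp
          ultimately show False
            using s0 g(2) by linarith
        qed
      qed
      \<comment> \<open>The summand from \<open>B\<close> must be 0. A summand \<open>j * g\<close>
        with \<open>j > 0\<close> leaves \<open>(k - j) * g + r\<close> in \<open>A\<close>, so
        \<open>(k - j) * g\<close> is in \<open>A\<close> by induction, and \<open>k * g\<close>
        gets a second representation besides \<open>k * g + 0\<close>.\<close>
      have "k * g + r \<in> A" if r: "r < g" for r
      proof -
        obtain a b where ab: "a \<in> A" "b \<in> B" "a + b = k * g + r"
          using complements_ex[OF AB] .
        have "b < k * g"
        proof (rule ccontr)
          assume "\<not> b < k * g"
          moreover from this have "b - k * g < g"
            using ab(3) r by linarith
          ultimately show False
            using not_B[of "b - k * g"] ab(2) by simp
        qed
        then obtain j where j: "b = j * g" "j < k"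
          using B_multiple[OF ab(2)] by (metis mult_less_cancel2)
        show ?thesis
        proof (cases "j = 0")
          case True
          with j ab show ?thesis by simp
        next
          case j0: False
          have kg: "k * g = (k - j) * g + j * g"
            using j(2) by (simp flip: add_mult_distrib)
          then have "a = (k - j) * g + r"
            using ab(3) j(1) by simp
          then have "(k - j) * g \<in> A"
            using block[of "k - j" r] r j0 False ab(1) by simp
          then have "b = 0"
            using uniq(2)[OF _ ab(2) \<open>k * g \<in> A\<close> zero(2), of "(k - j) * g"] kg j(1) by simp
          with j(1) j0 g(2) show ?thesis by simp
        qed
      qed
      with True not_B show ?thesis
        by blast
    next
      case notin: False
      obtain a b where ab: "a \<in> A" "b \<in> B" "a + b = k * g"
        using complements_ex[OF AB] .
      have b0: "b \<noteq> 0"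
        using ab notin by (cases "b = 0") auto
      obtain j where j: "b = j * g" "0 < j" "j \<le> k"
      proof (cases "b = k * g")
        case True
        with that[of k] False show ?thesis by simp
      next
        case bk: False
        with ab(3) have "b < k * g"
          by linarith
        with B_multiple[OF ab(2)] have "b = b div g * g" "b div g < k"
          by (simp_all add: less_mult_imp_div_less)
        with that[of "b div g"] b0 show ?thesis
          by (metis gr0I less_imp_le mult_0)
      qed
      have kg: "k * g = (k - j) * g + j * g"
        using j(3) by (simp flip: add_mult_distrib)
      with ab(3) j(1) have a: "a = (k - j) * g"
        by simp
      \<comment> \<open>Adding \<open>b\<close> to these elements represents every point of the
        block. Since \<open>b\<close> is nonzero, \<open>(k * g + r) + 0\<close> cannot be another
        representation; and \<open>0 + (k * g + r)\<close> can only be the same one, which forces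
        \<open>r = 0\<close>.\<close>
      have shifted: "(k - j) * g + r \<in> A" if "r < g" for r
        using block[of "k - j" r] that ab(1) a j(2,3) by simp
      have "k * g + r \<notin> A" if "r < g" for r
        using uniq(2)[OF shifted[OF that] ab(2) _ zero(2), of "k * g + r"] kg j(1) b0 by auto
      moreover have "r = 0" if "r < g" "k * g + r \<in> B" for r
        using uniq(2)[OF shifted[OF that(1)] ab(2) zero(1) that(2)]
          uniq(1)[OF shifted[OF that(1)] ab(2) zero(1) that(2)] kg j(1) by simp
      ultimately show ?thesis
        using notin by blast
    qed
  qed
qed

text \<open>The block structure allows both sets to be divided by \<open>g\<close>. Since
  \<open>g \<in> B\<close> becomes \<open>1 \<in> B'\<close>, the two sides exchange roles at the
  next reduction, so both must be kept infinite.\<close>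

lemma complements_reduce:
  assumes AB: "complements A B" and inf: "infinite A" "infinite B" and one: "1 \<in> A"
  obtains g A' B' where "2 \<le> g" "complements A' B'" "infinite A'" "infinite B'" "1 \<in> B'"
    "\<And>q r. q \<in> A' \<Longrightarrow> r < g \<Longrightarrow> q * g + r \<in> A" "\<And>q. q \<in> B' \<Longrightarrow> q * g \<in> B"
proof -
  define g where "g = (LEAST b. b \<in> B \<and> 0 < b)"
  have "\<exists>b. b \<in> B \<and> 0 < b"
    using inf(2) finite_subset[of B "{0}"] by (metis finite.simps gr0I singletonI subsetI)
  then have g: "g \<in> B" "0 < g"
    unfolding g_def by (metis (mono_tags, lifting) LeastI_ex)+
  have g_le: "g \<le> b" if "b \<in> B" "0 < b" for b
    unfolding g_def using that by (simp add: Least_le)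
  note uniq = complements_unique[OF AB]
  note block = complements_block[OF AB g g_le]
  define A' B' where "A' = {k. k * g \<in> A}" and "B' = {k. k * g \<in> B}"
  \<comment> \<open>Otherwise 1 would be both \<open>1 + 0\<close> and \<open>0 + 1\<close>.\<close>
  have "g \<noteq> 1"
    using uniq(1)[OF one complements_zero(2)[OF AB] complements_zero(1)[OF AB] g(1)] by auto
  with g(2) have "2 \<le> g"
    by simp
  have A_div: "a div g \<in> A'" if "a \<in> A" for a
    using block[of "a div g"] that g(2) unfolding A'_def
    by (metis div_mult_mod_eq mem_Collect_eq mod_less_divisor)
  have B_div: "b mod g = 0" "b div g \<in> B'" if "b \<in> B" for b
  proof -
    show "b mod g = 0"
      using block[of "b div g"] that g(2) by (metis div_mult_mod_eq mod_less_divisor)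
    with that show "b div g \<in> B'"
      unfolding B'_def by auto
  qed
  have "complements A' B'"
  proof (rule complementsI)
    fix n
    obtain a b where ab: "a \<in> A" "b \<in> B" "a + b = n * g"
      using complements_ex[OF AB] .
    \<comment> \<open>Quotients add up here because \<open>g\<close> divides
      \<open>b\<close>.\<close>
    have "a div g + b div g = n"
      using ab(3) B_div(1)[OF ab(2)] g(2)
      by (metis div_plus_div_distrib_dvd_right mod_eq_0_iff_dvd nonzero_mult_div_cancel_right not_gr_zero)
    with A_div[OF ab(1)] B_div(2)[OF ab(2)] show "\<exists>a\<in>A'. \<exists>b\<in>B'. a + b = n"
      by blast
  next
    fix a b a' b'
    assume *: "a \<in> A'" "b \<in> B'" "a' \<in> A'" "b' \<in> B'" "a + b = a' + b'"
    then have "a * g + b * g = a' * g + b' * g"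
      by (metis add_mult_distrib)
    with * uniq[of "a * g" "b * g" "a' * g" "b' * g"] g(2) show "a = a' \<and> b = b'"
      unfolding A'_def B'_def by simp
  qed
  moreover have "infinite A'"
  proof
    assume "finite A'"
    then have "finite ((\<lambda>(q, r). q * g + r) ` (A' \<times> {..<g}))"
      by simp
    moreover have "A \<subseteq> (\<lambda>(q, r). q * g + r) ` (A' \<times> {..<g})"
    proof
      fix a assume "a \<in> A"
      then show "a \<in> (\<lambda>(q, r). q * g + r) ` (A' \<times> {..<g})"
        using A_div g(2) by (intro image_eqI[of _ _ "(a div g, a mod g)"]) auto
    qed
    ultimately show False
      using inf(1) finite_subset by blast
  qed
  moreover have "infinite B'"
  proof
    assume "finite B'"
    then have "finite ((\<lambda>q. q * g) ` B')"
      by simp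
    moreover have "B \<subseteq> (\<lambda>q. q * g) ` B'"
    proof
      fix b assume "b \<in> B"
      then show "b \<in> (\<lambda>q. q * g) ` B'"
        using B_div[of b] by (intro image_eqI[of _ _ "b div g"]) auto
    qed
    ultimately show False
      using inf(2) finite_subset by blast
  qed
  moreover have "1 \<in> B'"
    unfolding B'_def using g(1) by simp
  moreover have "q * g + r \<in> A" if "q \<in> A'" "r < g" for q r
    using block[of q] that unfolding A'_def by blast
  moreover have "q * g \<in> B" if "q \<in> B'" for q
    using that unfolding B'_def by simp
  ultimately show ?thesis
    using that \<open>2 \<le> g\<close> by blast
qed

text \<open>Division rounds down, so 0 and -1 are fixed by it. For \<open>n \<le> -2\<close>,
  assuming \<open>n div g \<le> n\<close> gives \<open>(n div g + 1) * g \<le> (n + 1) * g \<le> 2 *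
  (n + 1) \<le> n\<close>, but the left side always exceeds \<open>n\<close>.\<close>

lemma abs_div_less:
  fixes n g :: int
  assumes "2 \<le> g" "n \<noteq> 0" "n \<noteq> -1"
  shows "\<bar>n div g\<bar> < \<bar>n\<bar>"
proof (cases "0 < n")
  case True
  then show ?thesis
    using assms int_div_less_self[of n g] by (simp add: pos_imp_zdiv_nonneg_iff)
next
  case False
  then have "n \<le> -2"
    using assms by linarith
  moreover have "n div g < 0"
    using \<open>n \<le> -2\<close> assms(1) by (intro div_neg_pos_less0) auto
  moreover have "n < n div g"
  proof (rule ccontr)
    assume "\<not> n < n div g"
    then have "(n div g + 1) * g \<le> (n + 1) * g"
      using assms(1) by (intro mult_right_mono) auto
    also have "\<dots> \<le> (n + 1) * 2"
      using \<open>n \<le> -2\<close> assms(1) by (intro mult_left_mono_neg) auto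
    also have "\<dots> \<le> n"
      using \<open>n \<le> -2\<close> by simp
    finally have "(n div g) * g + g \<le> n"
      by (simp add: algebra_simps)
    moreover have "n = n div g * g + n mod g" "n mod g < g"
      using assms(1) by simp_all
    ultimately show False
      by linarith
  qed
  ultimately show ?thesis
    by linarith
qed

lemma complements_diff_ex:
  assumes "complements A B" "infinite A" "infinite B"
  shows "\<exists>a\<in>A. \<exists>b\<in>B. int a - int b = n"
  using assms
proof (induction "nat \<bar>n\<bar>" arbitrary: n A B rule: less_induct)
  case less
  \<comment> \<open>Only the absolute value of \<open>m\<close> is tied to \<open>n\<close>, so that
    this serves both for \<open>A\<close>, \<open>B\<close>, \<open>n\<close> and, when 1 lies in
    \<open>B\<close>, for \<open>B\<close>, \<open>A\<close>, \<open>- n\<close>.\<close>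
  have *: "\<exists>a\<in>C. \<exists>b\<in>D. int a - int b = m"
    if CD: "complements C D" "infinite C" "infinite D" "1 \<in> C" and m: "\<bar>m\<bar> = \<bar>n\<bar>" for C D m
  proof -
    obtain g C' D' where g: "2 \<le> g" and CD': "complements C' D'" "infinite C'" "infinite D'" "1 \<in> D'"
      and C': "\<And>q r. q \<in> C' \<Longrightarrow> r < g \<Longrightarrow> q * g + r \<in> C" and D': "\<And>q. q \<in> D' \<Longrightarrow> q * g \<in> D"
      using complements_reduce[OF CD] by blast
    have "\<exists>a\<in>C'. \<exists>b\<in>D'. int a - int b = m div int g"
    proof -
      consider "m = 0" | "m = -1" | "m \<noteq> 0" "m \<noteq> -1"
        by blast
      then show ?thesis
      proof cases
        case 1
        with complements_zero[OF CD'(1)] show ?thesis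
          by force
      next
        case 2
        with g have "m div int g = -1"
          by (simp add: div_eq_minus1)
        with complements_zero(1)[OF CD'(1)] CD'(4) show ?thesis
          by force
      next
        case 3
        with abs_div_less[of "int g" m] g m show ?thesis
          using CD' by (intro less.hyps) auto
      qed
    qed
    then obtain a b where ab: "a \<in> C'" "b \<in> D'" "int a - int b = m div int g"
      by blast
    \<comment> \<open>The remainder of \<open>m\<close> modulo \<open>g\<close> is added on the side
      of \<open>C\<close>, which contains whole blocks.\<close>
    have "int (nat (m mod int g)) = m mod int g" "nat (m mod int g) < g"
      using g by (simp_all add: nat_less_iff)
    moreover have "(int a - int b) * int g + m mod int g = m"
      using ab(3) by simp
    ultimately have "int (a * g + nat (m mod int g)) - int (b * g) = m"
      by (simp add: algebra_simps)
    with C'[OF ab(1) \<open>nat (m mod int g) < g\<close>] D'[OF ab(2)] show ?thesis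
      by blast
  qed
  from complements_one[OF less.prems(1)] show ?case
  proof
    assume "1 \<in> A"
    with * less.prems show ?thesis
      by blast
  next
    assume "1 \<in> B"
    with *[of B A "- n"] less.prems complements_commute
    obtain b a where "b \<in> B" "a \<in> A" "int b - int a = - n"
      by auto
    then have "int a - int b = n"
      by linarith
    with \<open>b \<in> B\<close> \<open>a \<in> A\<close> show ?thesis
      by blast
  qed
qed

lemma complements_if_rep_sum:
  assumes "\<forall>n::int. n \<ge> 0 \<longrightarrow> rep_sum A B n = 1"
  shows "complements A B"
proof -
  have sing: "\<exists>p. {(a, b). a \<in> A \<and> b \<in> B \<and> a + b = n} = {p}" for n
    using assms[rule_format, of "int n"]
    by (simp add: rep_sum_def card_1_singleton_iff flip: of_nat_add)
  show ?thesis
  proof (rule complementsI)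
    show "\<exists>a\<in>A. \<exists>b\<in>B. a + b = n" for n
      using sing[of n] by blast
    show "a = a' \<and> b = b'"
      if "a \<in> A" "b \<in> B" "a' \<in> A" "b' \<in> B" "a + b = a' + b'" for a b a' b'
    proof -
      from sing[of "a + b"] obtain p
        where p: "{(x, y). x \<in> A \<and> y \<in> B \<and> x + y = a + b} = {p}"
        by blast
      have "(a, b) \<in> {p}" "(a', b') \<in> {p}"
        using that unfolding p[symmetric] by simp_all
      then show ?thesis
        by (metis prod.inject singletonD)
    qed
  qed
qed

theorem theorem2:
  fixes A B :: "nat set"
  assumes "infinite A" and "infinite B"
    and "\<forall>n::int. n \<ge> 0 \<longrightarrow> rep_sum A B n = 1"
  shows "\<forall>n::int. rep_diff A B n = 1"
proof
  fix n :: int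
  have AB: "complements A B"
    using assms(3) by (rule complements_if_rep_sum)
  obtain a b where ab: "a \<in> A" "b \<in> B" "int a - int b = n"
    using complements_diff_ex[OF AB assms(1,2)] by blast
  have "a' = a \<and> b' = b" if "a' \<in> A" "b' \<in> B" "int a' - int b' = n" for a' b'
  proof -
    have "a' + b = a + b'"
      using that(3) ab(3) by linarith
    from complements_unique[OF AB that(1) ab(2) ab(1) that(2) this] show ?thesis
      by simp
  qed
  \<comment> \<open>An explicit singleton, so the value 0 of \<open>card\<close> on infinite sets
    cannot interfere.\<close>
  with ab have "{(a, b). a \<in> A \<and> b \<in> B \<and> int a - int b = n} = {(a, b)}"
    by blast
  then show "rep_diff A B n = 1"
    by (simp add: rep_diff_def)
qed

end
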